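(* Let $n\ge 1$, let $\lambda$ be a partition with $l(\lambda)\le n$, and let $t,a,b,t_0,t_1,t_2,t_3$ be complex parameters of modulus less than $1$. Then the function $K_\lambda^{(n)}(z;t;a,b;t_0,\dots,t_3)$ (defined in the context as a sum over the hyperoctahedral group $B_n$) is a $BC_n$-symmetric Laurent polynomial in $z_1,\dots,z_n$, i.e. a Laurent polynomial invariant under permuting the variables $z_1,\dots,z_n$ and under each inversion $z_i\to z_i^{-1}$.
   Context: A partition $\lambda=(\lambda_1,\dots,\lambda_n)$ with $l(\lambda)\le n$ is a non-increasing string of $n$ non-negative integers (zeros allowed); $l(\lambda)$ is the number of nonzero parts, and $m_i(\lambda)$ is the number of indices $j\in\{1,\dots,n\}$ with $\lambda_j=i$, for $i\ge 0$. The hyperoctahedral group $B_n$ consists of pairs (permutation $\rho\in S_n$, signs $\epsilon_\rho(i)\in\{\pm1\}$), acting on functions of $z_1,\dots,z_n$ by $z_i\mapsto z_{\rho(i)}^{\epsilon_\rho(i)}$. Define $$v_{\lambda}(t;a,b;t_{0}, \dots, t_{3}) = \Bigg( \prod_{i \geq 0} \prod_{j=1}^{m_{i}(\lambda)} \frac{1- t^{j}}{1-t} \Bigg) \prod_{i=1}^{m_{1}(\lambda)} (1- t_{0}t_{1}t_{2}t_{3} t^{i-1+2m_{0}(\lambda)}) \prod_{i=1}^{m_{0}(\lambda)} (1-ab\, t^{i-1}),$$ and $$K_\lambda^{(n)}(z;t;a,b;t_0,\dots,t_3)= \frac{1}{v_{\lambda}(t;a,b;t_{0}, \dots, t_{3})}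 \sum_{w \in B_{n}} w \Bigg( \prod_{1 \leq i \leq n} u_{\lambda}(z_{i}) \prod_{1 \leq i<j \leq n} \frac{1-tz_{i}^{-1}z_{j}}{1-z_{i}^{-1}z_{j}}\, \frac{1-tz_{i}^{-1}z_{j}^{-1}}{1-z_{i}^{-1}z_{j}^{-1}} \Bigg),$$ where $$u_\lambda(z_i)=\frac{(1-az_i^{-1})(1-bz_i^{-1})}{1-z_i^{-2}}\ \text{ if }\lambda_i=0,\qquad u_\lambda(z_i)=z_i^{\lambda_i}\,\frac{(1-t_0z_i^{-1})(1-t_1z_i^{-1})(1-t_2z_i^{-1})(1-t_3z_i^{-1})}{1-z_i^{-2}}\ \text{ if }\lambda_i>0.$$ *)

theory Defs
  imports Complex_Main "HOL-Library.Poly_Mapping" "HOL-Library.FuncSet"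
    "HOL-Combinatorics.Permutations"
begin

text \<open>
  Partitions and points are functions on \<open>nat\<close> of which only the values on the
  index set \<open>{1..n}\<close> matter.
\<close>

definition is_partition :: "nat \<Rightarrow> (nat \<Rightarrow> nat) \<Rightarrow> bool" where
  "is_partition n lam \<longleftrightarrow> (\<forall>i\<in>{1..n}. \<forall>j\<in>{1..n}. i \<le> j \<longrightarrow> lam j \<le> lam i)"

definition part_mult :: "nat \<Rightarrow> (nat \<Rightarrow> nat) \<Rightarrow> nat \<Rightarrow> nat" where
  "part_mult n lam i = card {j \<in> {1..n}. lam j = i}"

text \<open>
  The sign vectors are extensional functions, so that each element of the group is
  represented by exactly one pair.
\<close>

definition hyperoctahedral :: "nat \<Rightarrow> ((nat \<Rightarrow> nat) \<times> (nat \<Rightarrow> int)) set" where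
  "hyperoctahedral n = {\<rho>. \<rho> permutes {1..n}} \<times> ({1..n} \<rightarrow>\<^sub>E {1, -1})"

definition hyperoctahedral_act ::
    "(nat \<Rightarrow> nat) \<times> (nat \<Rightarrow> int) \<Rightarrow> ((nat \<Rightarrow> complex) \<Rightarrow> complex) \<Rightarrow> (nat \<Rightarrow> complex) \<Rightarrow> complex" where
  "hyperoctahedral_act w f = (\<lambda>z. f (\<lambda>i. z (fst w i) powi snd w i))"

text \<open>
  In the first product only the finitely many \<open>i\<close> with nonzero multiplicity
  contribute a factor different from \<open>1\<close>.
\<close>

definition v_norm :: "nat \<Rightarrow> (nat \<Rightarrow> nat) \<Rightarrow> complex \<Rightarrow> complex \<Rightarrow> complex \<Rightarrow>
    complex \<Rightarrow> complex \<Rightarrow> complex \<Rightarrow> complex \<Rightarrow> complex" where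
  "v_norm n lam t a b t0 t1 t2 t3 =
     (\<Prod>i | part_mult n lam i \<noteq> 0. \<Prod>j = 1..part_mult n lam i. (1 - t ^ j) / (1 - t)) *
     (\<Prod>i = 1..part_mult n lam 1. 1 - t0 * t1 * t2 * t3 * t ^ (i - 1 + 2 * part_mult n lam 0)) *
     (\<Prod>i = 1..part_mult n lam 0. 1 - a * b * t ^ (i - 1))"

definition u_factor :: "nat \<Rightarrow> complex \<Rightarrow> complex \<Rightarrow> complex \<Rightarrow> complex \<Rightarrow> complex \<Rightarrow>
    complex \<Rightarrow> complex \<Rightarrow> complex" where
  "u_factor k a b t0 t1 t2 t3 x =
     (if k = 0 then (1 - a * inverse x) * (1 - b * inverse x) / (1 - inverse x ^ 2)
      else x ^ k * ((1 - t0 * inverse x) * (1 - t1 * inverse x) *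
                    (1 - t2 * inverse x) * (1 - t3 * inverse x) / (1 - inverse x ^ 2)))"

definition K_summand :: "nat \<Rightarrow> (nat \<Rightarrow> nat) \<Rightarrow> complex \<Rightarrow> complex \<Rightarrow> complex \<Rightarrow>
    complex \<Rightarrow> complex \<Rightarrow> complex \<Rightarrow> complex \<Rightarrow> (nat \<Rightarrow> complex) \<Rightarrow> complex" where
  "K_summand n lam t a b t0 t1 t2 t3 z =
     (\<Prod>i = 1..n. u_factor (lam i) a b t0 t1 t2 t3 (z i)) *
     (\<Prod>i = 1..n. \<Prod>j \<in> {i<..n}.
        (1 - t * inverse (z i) * z j) / (1 - inverse (z i) * z j) *
        ((1 - t * inverse (z i) * inverse (z j)) / (1 - inverse (z i) * inverse (z j))))"

definition K_fun :: "nat \<Rightarrow> (nat \<Rightarrow> nat) \<Rightarrow> (nat \<Rightarrow> complex) \<Rightarrow> complex \<Rightarrow> complex \<Rightarrow> complex \<Rightarrow>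
    complex \<Rightarrow> complex \<Rightarrow> complex \<Rightarrow> complex \<Rightarrow> complex" where
  "K_fun n lam z t a b t0 t1 t2 t3 =
     1 / v_norm n lam t a b t0 t1 t2 t3 *
     (\<Sum>w \<in> hyperoctahedral n.
        hyperoctahedral_act w (K_summand n lam t a b t0 t1 t2 t3) z)"

text \<open>
  \<open>K_fun\<close> is a rational function of \<open>z\<close>; these are the points of the torus at
  which no denominator of any of its summands vanishes. They form a nonempty Zariski-open set, so a
  Laurent polynomial is determined by its values there.
\<close>

definition regular_point :: "nat \<Rightarrow> (nat \<Rightarrow> complex) \<Rightarrow> bool" where
  "regular_point n z \<longleftrightarrow>
     (\<forall>i\<in>{1..n}. z i \<noteq> 0 \<and> z i ^ 2 \<noteq> 1) \<and>
     (\<forall>i\<in>{1..n}. \<forall>j\<in>{1..n}. i \<noteq> j \<longrightarrow> z i \<noteq> z j \<and> z i * z j \<noteq> 1)"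

text \<open>
  Laurent polynomials form the monoid algebra of the integer exponent vectors: an element maps
  finitely many exponent vectors to nonzero coefficients.
\<close>

type_synonym laurent = "(nat \<Rightarrow>\<^sub>0 int) \<Rightarrow>\<^sub>0 complex"

definition laurent_vars_le :: "nat \<Rightarrow> laurent \<Rightarrow> bool" where
  "laurent_vars_le n P \<longleftrightarrow> (\<forall>\<alpha> \<in> Poly_Mapping.keys P. Poly_Mapping.keys \<alpha> \<subseteq> {1..n})"

definition laurent_eval :: "laurent \<Rightarrow> (nat \<Rightarrow> complex) \<Rightarrow> complex" where
  "laurent_eval P z =
     (\<Sum>\<alpha> \<in> Poly_Mapping.keys P. Poly_Mapping.lookup P \<alpha> *
        (\<Prod>i \<in> Poly_Mapping.keys \<alpha>. z i powi Poly_Mapping.lookup \<alpha> i))"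

definition BC_symmetric :: "nat \<Rightarrow> laurent \<Rightarrow> bool" where
  "BC_symmetric n P \<longleftrightarrow>
     (\<forall>z. (\<forall>i\<in>{1..n}. z i \<noteq> 0) \<longrightarrow>
        (\<forall>\<rho>. \<rho> permutes {1..n} \<longrightarrow> laurent_eval P (\<lambda>i. z (\<rho> i)) = laurent_eval P z) \<and>
        (\<forall>i\<in>{1..n}. laurent_eval P (z(i := inverse (z i))) = laurent_eval P z))"

end

theory Submission
  imports Defs "Jordan_Normal_Form.Determinant"
begin

text \<open>
  Put \<open>y\<^sub>i = z\<^sub>i + 1/z\<^sub>i\<close>. Since
  \<open>(1 - z\<^sub>j/z\<^sub>i) (1 - 1/(z\<^sub>i z\<^sub>j)) = (y\<^sub>i - y\<^sub>j)/z\<^sub>i\<close> and \<open>1 - 1/z\<^sub>i\<^sup>2 = (z\<^sub>i - 1/z\<^sub>i)/z\<^sub>i\<close>,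
  every summand of \<open>K_fun\<close> is a Laurent polynomial divided by the Weyl denominator
  of type \<open>C\<^sub>n\<close>,
  the product of all \<open>z\<^sub>i - 1/z\<^sub>i\<close> and of the Vandermonde product of the \<open>y\<^sub>i\<close>
  (\<open>K_summand_eq\<close>). It therefore suffices to show that the sum of \<open>f / denominator\<close> over the group
  is a Laurent polynomial for every Laurent polynomial \<open>f\<close>, and by linearity for every monomial
  \<open>f\<close> (\<open>symmetrized_laurent_fun\<close>).

  For a monomial with exponents \<open>e\<^sub>i\<close> the sum over the signs factors into the characters
  \<open>(x^e - x^-e) / (x - 1/x)\<close>, which are polynomials in \<open>x + 1/x\<close>, and what remains is an alternant in
  the \<open>y\<^sub>i\<close> divided by the Vandermonde product. Newton interpolation of these polynomials at the
  nodes \<open>y\<^sub>1, y\<^sub>2, \<dots>\<close> factors the matrix of the alternant into a triangular matrix, whose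
  determinant is the Vandermonde product, and the matrix of divided differences, whose entries are
  polynomials in the \<open>y\<^sub>i\<close> (\<open>det_alternant\<close>). So the quotient is the determinant of the latter
  (\<open>alternating_sum_eq_det\<close>), and the division needs no argument about unique factorization in
  several variables.

  The Laurent polynomial so obtained agrees with the sum over the group, hence is invariant, at
  regular points, whereas invariance is claimed on the whole torus. Averaging it over the group
  achieves this without changing its values at regular points.
\<close>

section \<open>Laurent polynomial functions\<close>

definition torus :: "nat \<Rightarrow> (nat \<Rightarrow> complex) \<Rightarrow> bool" where
  "torus n z \<longleftrightarrow> (\<forall>i\<in>{1..n}. z i \<noteq> 0)"

text \<open>
  Equations between these functions hold only where all variables are nonzero, so both rules speak
  about values on the torus only. Presenting Laurent polynomials as sums of monomials turns every
  statement that is linear in one of them into an induction with a single essential case.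
\<close>

inductive laurent_fun :: "nat \<Rightarrow> ((nat \<Rightarrow> complex) \<Rightarrow> complex) \<Rightarrow> bool" for n where
  monomial: "\<forall>z. torus n z \<longrightarrow> f z = c * (\<Prod>i=1..n. z i powi e i) \<Longrightarrow> laurent_fun n f"
| add: "laurent_fun n f \<Longrightarrow> laurent_fun n g \<Longrightarrow> \<forall>z. torus n z \<longrightarrow> h z = f z + g z \<Longrightarrow>
    laurent_fun n h"

lemma laurent_fun_const: "laurent_fun n (\<lambda>z. c)"
  by (rule laurent_fun.monomial[of _ _ c "\<lambda>_. 0"]) auto

lemma laurent_fun_cong:
  assumes "laurent_fun n f" "\<And>z. torus n z \<Longrightarrow> g z = f z"
  shows "laurent_fun n g"
  using laurent_fun.add[OF assms(1) laurent_fun_const[of n 0]] assms(2) by simp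

lemma laurent_fun_add: "laurent_fun n f \<Longrightarrow> laurent_fun n g \<Longrightarrow> laurent_fun n (\<lambda>z. f z + g z)"
  by (erule laurent_fun.add) auto

lemma laurent_fun_mult:
  assumes "laurent_fun n f" "laurent_fun n g"
  shows "laurent_fun n (\<lambda>z. f z * g z)"
  using assms
proof (induction arbitrary: g rule: laurent_fun.induct)
  case (monomial f c e)
  from monomial(2) show ?case
  proof (induction rule: laurent_fun.induct)
    case m2: (monomial g d e')
    show ?case
    proof (rule laurent_fun.monomial, intro allI impI)
      fix z assume z: "torus n z"
      then have "(\<Prod>i=1..n. z i powi (e i + e' i)) =
          (\<Prod>i=1..n. z i powi e i) * (\<Prod>i=1..n. z i powi e' i)"
        unfolding prod.distrib[symmetric]
        by (intro prod.cong) (auto simp: torus_def power_int_add)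
      then show "f z * g z = (c * d) * (\<Prod>i=1..n. z i powi (e i + e' i))"
        using monomial(1) m2 z by simp
    qed
  next
    case (add g1 g2 h)
    show ?case
      by (rule laurent_fun.add[OF add.IH]) (use add.hyps in \<open>simp add: distrib_left\<close>)
  qed
next
  case (add f1 f2 h)
  show ?case
    by (rule laurent_fun.add[OF add.IH(1)[OF add.prems] add.IH(2)[OF add.prems]])
      (use add.hyps in \<open>simp add: distrib_right\<close>)
qed

lemma laurent_fun_diff:
  assumes "laurent_fun n f" "laurent_fun n g"
  shows "laurent_fun n (\<lambda>z. f z - g z)"
  using laurent_fun_add[OF assms(1) laurent_fun_mult[OF laurent_fun_const[of n "-1"] assms(2)]]
  by simp

lemma laurent_fun_sum:
  assumes "\<And>a. a \<in> A \<Longrightarrow> laurent_fun n (f a)"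
  shows "laurent_fun n (\<lambda>z. \<Sum>a\<in>A. f a z)"
  using assms
  by (induction A rule: infinite_finite_induct) (auto intro: laurent_fun_const laurent_fun_add)

lemma laurent_fun_prod:
  assumes "\<And>a. a \<in> A \<Longrightarrow> laurent_fun n (f a)"
  shows "laurent_fun n (\<lambda>z. \<Prod>a\<in>A. f a z)"
  using assms
  by (induction A rule: infinite_finite_induct) (auto intro: laurent_fun_const laurent_fun_mult)

lemma laurent_fun_powi:
  assumes "j \<in> {1..n}"
  shows "laurent_fun n (\<lambda>z. z j powi k)"
proof (rule laurent_fun.monomial, intro allI impI)
  fix z :: "nat \<Rightarrow> complex"
  have "(\<Prod>i=1..n. z i powi (if i = j then k else 0)) = (\<Prod>i=1..n. if i = j then z j powi k else 1)"
    by (intro prod.cong) auto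
  then show "z j powi k = 1 * (\<Prod>i=1..n. z i powi (if i = j then k else 0))"
    using assms by simp
qed

lemma laurent_fun_var:
  assumes "j \<in> {1..n}"
  shows "laurent_fun n (\<lambda>z. z j)" "laurent_fun n (\<lambda>z. inverse (z j))"
  using laurent_fun_powi[OF assms, of 1] laurent_fun_powi[OF assms, of "-1"]
  by (simp_all add: power_int_minus)

lemma laurent_fun_power:
  assumes "laurent_fun n f"
  shows "laurent_fun n (\<lambda>z. f z ^ k)"
  by (induction k) (auto intro: laurent_fun_const laurent_fun_mult assms)

lemmas laurent_fun_intros = laurent_fun_const laurent_fun_add laurent_fun_diff laurent_fun_mult
  laurent_fun_sum laurent_fun_prod laurent_fun_powi laurent_fun_var laurent_fun_power

text \<open>
  Points are functions on all of \<open>nat\<close>, and the group action leaves them uncontrolled outside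
  \<open>{1..n}\<close>; this lemma permits comparing points on \<open>{1..n}\<close> alone.
\<close>

lemma laurent_fun_local:
  assumes "laurent_fun n f" "torus n x" "\<And>i. i \<in> {1..n} \<Longrightarrow> x i = y i"
  shows "f x = f y"
proof -
  have "torus n y" using assms(2,3) by (auto simp: torus_def)
  with assms(1) show ?thesis
  proof (induction rule: laurent_fun.induct)
    case (monomial f c e)
    have "(\<Prod>i=1..n. x i powi e i) = (\<Prod>i=1..n. y i powi e i)"
      by (rule prod.cong) (simp_all add: assms(3))
    then show ?case using monomial assms(2) by simp
  qed (use assms(2) in simp)
qed

lemma laurent_eval_superset:
  assumes "finite A" "Poly_Mapping.keys P \<subseteq> A"
  shows "laurent_eval P z = (\<Sum>\<alpha>\<in>A. Poly_Mapping.lookup P \<alpha> *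
        (\<Prod>i \<in> Poly_Mapping.keys \<alpha>. z i powi Poly_Mapping.lookup \<alpha> i))"
  unfolding laurent_eval_def
  by (rule sum.mono_neutral_left) (use assms in \<open>auto simp: Poly_Mapping.in_keys_iff\<close>)

lemma laurent_eval_add: "laurent_eval (P + Q) z = laurent_eval P z + laurent_eval Q z"
proof -
  let ?A = "Poly_Mapping.keys P \<union> Poly_Mapping.keys Q"
  have "Poly_Mapping.keys (P + Q) \<subseteq> ?A" by (rule Poly_Mapping.keys_add)
  then show ?thesis
    by (simp add: laurent_eval_superset[of ?A] lookup_add distrib_right sum.distrib)
qed

lemma laurent_fun_imp_laurent_eval:
  assumes "laurent_fun n f"
  shows "\<exists>P. laurent_vars_le n P \<and> (\<forall>z. torus n z \<longrightarrow> laurent_eval P z = f z)"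
  using assms
proof (induction rule: laurent_fun.induct)
  case (monomial f c e)
  define \<alpha> where "\<alpha> = Abs_poly_mapping (\<lambda>i. if i \<in> {1..n} then e i else 0)"
  have lk: "Poly_Mapping.lookup \<alpha> i = (if i \<in> {1..n} then e i else 0)" for i
    unfolding \<alpha>_def by (subst Abs_poly_mapping_inverse) (auto intro: finite_subset[of _ "{1..n}"])
  have keys: "Poly_Mapping.keys \<alpha> \<subseteq> {1..n}"
    by (auto simp: Poly_Mapping.in_keys_iff lk split: if_splits)
  define P where "P = Poly_Mapping.single \<alpha> c"
  have "laurent_eval P z = f z" if "torus n z" for z
  proof -
    have "laurent_eval P z = c * (\<Prod>i \<in> Poly_Mapping.keys \<alpha>. z i powi Poly_Mapping.lookup \<alpha> i)"
      by (subst laurent_eval_superset[of "{\<alpha>}"]) (auto simp: P_def)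
    also have "(\<Prod>i \<in> Poly_Mapping.keys \<alpha>. z i powi Poly_Mapping.lookup \<alpha> i) =
        (\<Prod>i=1..n. z i powi Poly_Mapping.lookup \<alpha> i)"
      by (rule prod.mono_neutral_left) (use keys in \<open>auto simp: Poly_Mapping.in_keys_iff\<close>)
    also have "\<dots> = (\<Prod>i=1..n. z i powi e i)"
      by (rule prod.cong) (auto simp: lk)
    finally show ?thesis using monomial that by simp
  qed
  moreover have "laurent_vars_le n P"
    using keys by (auto simp: laurent_vars_le_def P_def)
  ultimately show ?case by blast
next
  case (add f g h)
  then obtain P Q where
    PQ: "laurent_vars_le n P" "laurent_vars_le n Q"
      "\<And>z. torus n z \<Longrightarrow> laurent_eval P z = f z" "\<And>z. torus n z \<Longrightarrow> laurent_eval Q z = g z"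
    by blast
  have "laurent_vars_le n (P + Q)"
    using PQ(1,2) Poly_Mapping.keys_add[of P Q] unfolding laurent_vars_le_def by blast
  then show ?case using PQ(3,4) add.hyps(3) by (intro exI[of _ "P + Q"]) (simp add: laurent_eval_add)
qed

section \<open>Sums over the hyperoctahedral group\<close>

abbreviation hyp_apply ::
  "(nat \<Rightarrow> nat) \<times> (nat \<Rightarrow> int) \<Rightarrow> (nat \<Rightarrow> complex) \<Rightarrow> nat \<Rightarrow> complex" where
  "hyp_apply w z \<equiv> (\<lambda>i. z (fst w i) powi snd w i)"

lemma finite_hyperoctahedral: "finite (hyperoctahedral n)"
  unfolding hyperoctahedral_def by (intro finite_SigmaI finite_PiE finite_permutations) auto

lemma hyperoctahedral_cases:
  assumes "w \<in> hyperoctahedral n" "i \<in> {1..n}"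
  shows "fst w i \<in> {1..n}" "snd w i = 1 \<or> snd w i = -1"
proof -
  have "fst w permutes {1..n}" "snd w i \<in> {1, -1}"
    using assms by (auto simp: hyperoctahedral_def PiE_iff)
  then show "fst w i \<in> {1..n}" "snd w i = 1 \<or> snd w i = -1"
    using assms(2) by (simp_all only: permutes_in_image) auto
qed

lemma torus_hyp_apply:
  assumes "w \<in> hyperoctahedral n" "torus n z"
  shows "torus n (hyp_apply w z)"
  using assms hyperoctahedral_cases[OF assms(1)] by (auto simp: torus_def)

text \<open>
  Acting on the point by \<open>v\<close> reindexes the sum by left translation by \<open>v\<close>. The sign vector of the
  product takes its sign of \<open>v\<close> at the permuted index because the permutation of \<open>w\<close> acts first.
\<close>

lemma hyperoctahedral_sum_invariant:
  assumes local: "\<And>x y. torus n x \<Longrightarrow> (\<And>i. i \<in> {1..n} \<Longrightarrow> x i = y i) \<Longrightarrow> F x = F y"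
    and v: "v \<in> hyperoctahedral n" and z: "torus n z"
  shows "(\<Sum>w\<in>hyperoctahedral n. F (hyp_apply w (hyp_apply v z))) =
    (\<Sum>w\<in>hyperoctahedral n. F (hyp_apply w z))"
proof -
  define h where "h w = (fst v \<circ> fst w, \<lambda>i\<in>{1..n}. snd v (fst w i) * snd w i)"
    for w :: "(nat \<Rightarrow> nat) \<times> (nat \<Rightarrow> int)"
  have perm: "fst v permutes {1..n}" using v by (auto simp: hyperoctahedral_def)
  have into: "h w \<in> hyperoctahedral n" if w: "w \<in> hyperoctahedral n" for w
  proof -
    have "fst w permutes {1..n}" using w by (auto simp: hyperoctahedral_def)
    then have "fst v \<circ> fst w permutes {1..n}" by (rule permutes_compose[OF _ perm])
    moreover have "snd v (fst w i) * snd w i \<in> {1, -1}" if "i \<in> {1..n}" for i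
      using hyperoctahedral_cases[OF w that] hyperoctahedral_cases(2)[OF v, of "fst w i"] by auto
    ultimately show ?thesis by (auto simp: h_def hyperoctahedral_def)
  qed
  have inj: "inj_on h (hyperoctahedral n)"
  proof (rule inj_onI)
    fix w w' assume w: "w \<in> hyperoctahedral n" and w': "w' \<in> hyperoctahedral n" and eq: "h w = h w'"
    have "fst v \<circ> fst w = fst v \<circ> fst w'" using eq by (simp add: h_def)
    then have f: "fst w = fst w'" using permutes_inj[OF perm] by (simp add: fun.inj_map_strong inj_compose fun_eq_iff inj_eq)
    have "snd w i = snd w' i" if i: "i \<in> {1..n}" for i
    proof -
      have "snd (h w) i = snd (h w') i" using eq by simp
      then have "snd v (fst w i) * snd w i = snd v (fst w i) * snd w' i"
        unfolding h_def using i f by simp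
      moreover have "snd v (fst w i) \<noteq> 0"
        using hyperoctahedral_cases(2)[OF v hyperoctahedral_cases(1)[OF w i]] by auto
      ultimately show ?thesis by simp
    qed
    moreover have "snd w \<in> extensional {1..n}" "snd w' \<in> extensional {1..n}"
      using w w' by (auto simp: hyperoctahedral_def PiE_iff)
    ultimately have "snd w = snd w'" by (intro extensionalityI) auto
    with f show "w = w'" by (simp add: prod_eq_iff)
  qed
  have bij: "bij_betw h (hyperoctahedral n) (hyperoctahedral n)"
    using inj into finite_hyperoctahedral[of n]
    by (metis bij_betw_def endo_inj_surj image_subsetI)
  have "F (hyp_apply w (hyp_apply v z)) = F (hyp_apply (h w) z)" if w: "w \<in> hyperoctahedral n" for w
  proof (rule local)
    show "torus n (hyp_apply w (hyp_apply v z))"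
      using torus_hyp_apply[OF w torus_hyp_apply[OF v z]] by simp
    show "hyp_apply w (hyp_apply v z) i = hyp_apply (h w) z i" if "i \<in> {1..n}" for i
      using that by (simp add: h_def power_int_mult[symmetric])
  qed
  then have "(\<Sum>w\<in>hyperoctahedral n. F (hyp_apply w (hyp_apply v z))) =
      (\<Sum>w\<in>hyperoctahedral n. F (hyp_apply (h w) z))"
    by (rule sum.cong[OF refl])
  also have "\<dots> = (\<Sum>w\<in>hyperoctahedral n. F (hyp_apply w z))"
    by (rule sum.reindex_bij_betw[OF bij])
  finally show ?thesis .
qed

section \<open>Newton interpolation of the characters of SL(2)\<close>

text \<open>
  For \<open>e > 0\<close> this is the Chebyshev polynomial of the second kind of degree \<open>e - 1\<close>, normalized to
  be monic in \<open>x + 1/x\<close>; it is the character of the irreducible representation of \<open>SL(2)\<close> of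
  dimension \<open>e\<close>.
\<close>

definition sl2_char :: "int \<Rightarrow> complex \<Rightarrow> complex" where
  "sl2_char e x = (x powi e - x powi (- e)) / (x - inverse x)"

definition newton_basis :: "(nat \<Rightarrow> complex) \<Rightarrow> nat \<Rightarrow> complex \<Rightarrow> complex" where
  "newton_basis y m s = (\<Prod>l<m. s - y l)"

text \<open>
  The divided difference at the nodes \<open>y 0, \<dots>, y m\<close> of the polynomial that expresses
  \<open>sl2_char e x\<close> through \<open>x + 1/x\<close>. The recursion combines the three-term recurrence
  of Chebyshev polynomials with the rule \<open>(s * P)[y\<^sub>0,\<dots>,y\<^sub>m] = y\<^sub>m * P[y\<^sub>0,\<dots>,y\<^sub>m] +
  P[y\<^sub>0,\<dots>,y\<^bsub>m-1\<^esub>]\<close>, and involves no division: the coefficients are polynomials in the nodes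
  even when nodes coincide.
\<close>

fun newton_coeff :: "(nat \<Rightarrow> complex) \<Rightarrow> nat \<Rightarrow> nat \<Rightarrow> complex" where
  "newton_coeff y m 0 = 0"
| "newton_coeff y m (Suc 0) = (if m = 0 then 1 else 0)"
| "newton_coeff y m (Suc (Suc e)) = y m * newton_coeff y m (Suc e) +
     (case m of 0 \<Rightarrow> 0 | Suc m' \<Rightarrow> newton_coeff y m' (Suc e)) - newton_coeff y m e"

definition newton_coeff_int :: "(nat \<Rightarrow> complex) \<Rightarrow> nat \<Rightarrow> int \<Rightarrow> complex" where
  "newton_coeff_int y m e = (if e \<ge> 0 then newton_coeff y m (nat e) else - newton_coeff y m (nat (- e)))"

lemma sl2_char_minus: "sl2_char (- e) x = - sl2_char e x"
  by (simp add: sl2_char_def minus_divide_left[symmetric] del: minus_divide_left) 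
    (simp add: minus_divide_left)

lemma sub_inverse_nonzero:
  assumes "(x::complex) \<noteq> 0" "x ^ 2 \<noteq> 1"
  shows "x - inverse x \<noteq> 0"
  using assms by (auto simp: field_simps power2_eq_square)

lemma sl2_char_recurrence:
  assumes "x \<noteq> 0"
  shows "sl2_char (e + 2) x = (x + inverse x) * sl2_char (e + 1) x - sl2_char e x"
proof -
  have "x powi (e + 2) - x powi (- (e + 2)) =
     (x + inverse x) * (x powi (e + 1) - x powi (- (e + 1))) - (x powi e - x powi (- e))"
    using assms by (simp add: power_int_add power_int_diff power_int_minus field_simps power2_eq_square)
  then show ?thesis
    unfolding sl2_char_def by (simp only: times_divide_eq_right diff_divide_distrib[symmetric])
qed

text \<open>
  The Newton expansion is an identity of polynomials with a sum over all \<open>m\<close>; at the node \<open>y i\<close>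
  the basis polynomials with \<open>m > i\<close> vanish, so that \<open>n\<close> terms suffice whatever the degree.
\<close>

lemma newton_interpolation:
  assumes "x \<noteq> 0" "x ^ 2 \<noteq> 1" "i < n" "x + inverse x = y i"
  shows "sl2_char (int e) x = (\<Sum>m<n. newton_basis y m (y i) * newton_coeff y m e)"
proof (induction e rule: induct_nat_012)
  case 0
  show ?case by (simp add: sl2_char_def)
next
  case 1
  have "sl2_char 1 x = 1"
    using sub_inverse_nonzero[OF assms(1,2)] by (simp add: sl2_char_def power_int_minus)
  moreover have "(\<Sum>m<n. newton_basis y m (y i) * (if m = 0 then 1 else 0)) = newton_basis y 0 (y i)"
    using assms(3) by (subst sum.remove[of _ 0]) auto
  ultimately show ?case by (simp add: newton_basis_def)
next
  case (ge2 e)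
  let ?N = "\<lambda>m. newton_basis y m (y i)" and ?c = "\<lambda>m. newton_coeff y m (Suc e)"
  \<comment> \<open>Multiplication by the variable maps a basis polynomial to a combination of two neighbours.\<close>
  have N: "y i * ?N m = y m * ?N m + ?N (Suc m)" for m
    by (simp add: newton_basis_def algebra_simps)
  have Nn: "?N n = 0"
    using assms(3) by (auto simp: newton_basis_def intro!: bexI[of _ i])
  have shift: "(\<Sum>m<n. ?N (Suc m) * ?c m) = (\<Sum>m<n. ?N m * (case m of 0 \<Rightarrow> 0 | Suc m' \<Rightarrow> ?c m'))"
  proof -
    have "(\<Sum>m<Suc n. ?N m * (case m of 0 \<Rightarrow> 0 | Suc m' \<Rightarrow> ?c m')) = (\<Sum>m<n. ?N (Suc m) * ?c m)"
      by (subst sum.lessThan_Suc_shift) simp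
    then show ?thesis
      using Nn assms(3) by (cases n) (simp_all)
  qed
  have "sl2_char (int (Suc (Suc e))) x = y i * sl2_char (int (Suc e)) x - sl2_char (int e) x"
    using sl2_char_recurrence[OF assms(1), of "int e"] assms(4) by (simp add: ac_simps)
  also have "y i * sl2_char (int (Suc e)) x = (\<Sum>m<n. (y i * ?N m) * ?c m)"
    unfolding ge2 by (simp add: sum_distrib_left mult.assoc)
  also have "\<dots> = (\<Sum>m<n. ?N m * (y m * ?c m)) + (\<Sum>m<n. ?N (Suc m) * ?c m)"
    unfolding N by (simp add: sum.distrib[symmetric] algebra_simps)
  finally show ?case
    unfolding shift ge2 by (simp add: sum.distrib[symmetric] sum_subtractf[symmetric] algebra_simps)
qed

lemma newton_interpolation_int:
  assumes "x \<noteq> 0" "x ^ 2 \<noteq> 1" "i < n" "x + inverse x = y i"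
  shows "sl2_char e x = (\<Sum>m<n. newton_basis y m (y i) * newton_coeff_int y m e)"
proof (cases "e \<ge> 0")
  case True
  then show ?thesis
    using newton_interpolation[of x i n y "nat e"] assms by (simp add: newton_coeff_int_def)
next
  case False
  then show ?thesis
    using newton_interpolation[of x i n y "nat (- e)"] assms sl2_char_minus[of "- e" x]
    by (simp add: newton_coeff_int_def sum_negf)
qed

lemma newton_coeff_zero: "e \<le> m \<Longrightarrow> newton_coeff y m e = 0"
  by (induction y m e rule: newton_coeff.induct) (auto split: nat.splits)

lemma newton_coeff_diag: "newton_coeff y m (Suc m) = 1"
proof (induction m)
  case (Suc m)
  then show ?case by (simp add: newton_coeff_zero)
qed simp

section \<open>Alternants divided by the Vandermonde product\<close>

definition alternant :: "nat \<Rightarrow> (nat \<Rightarrow> int) \<Rightarrow> (nat \<Rightarrow> complex) \<Rightarrow> complex mat" where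
  "alternant n e x = mat n n (\<lambda>(i, j). sl2_char (e j) (x i))"

definition coeff_mat :: "nat \<Rightarrow> (nat \<Rightarrow> int) \<Rightarrow> (nat \<Rightarrow> complex) \<Rightarrow> complex mat" where
  "coeff_mat n e y = mat n n (\<lambda>(m, j). newton_coeff_int y m (e j))"

definition vandermonde :: "nat \<Rightarrow> (nat \<Rightarrow> complex) \<Rightarrow> complex" where
  "vandermonde n y = (\<Prod>i<n. \<Prod>l<i. y i - y l)"

lemma prod_list_diag_mat:
  assumes "A \<in> carrier_mat n n"
  shows "prod_list (diag_mat A) = (\<Prod>i<n. A $$ (i, i))"
  using assms by (simp add: prod_list_diag_prod atLeast0LessThan)

text \<open>
  Newton interpolation writes the alternant as a product of matrices. The left factor
  \<open>newton_basis y m (y i)\<close> is lower triangular, and its diagonal entries are the inner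
  products in \<open>vandermonde\<close>.
\<close>

lemma det_alternant:
  assumes "\<And>i. i < n \<Longrightarrow> x i \<noteq> 0 \<and> x i ^ 2 \<noteq> 1"
  shows "det (alternant n e x) =
    vandermonde n (\<lambda>i. x i + inverse (x i)) * det (coeff_mat n e (\<lambda>i. x i + inverse (x i)))"
proof -
  define y where "y = (\<lambda>i. x i + inverse (x i))"
  define L where "L = mat n n (\<lambda>(i, m). newton_basis y m (y i))"
  have L: "L \<in> carrier_mat n n" by (simp add: L_def)
  have C: "coeff_mat n e y \<in> carrier_mat n n" by (simp add: coeff_mat_def)
  have "alternant n e x = L * coeff_mat n e y"
  proof (rule eq_matI)
    fix i j assume "i < dim_row (L * coeff_mat n e y)" "j < dim_col (L * coeff_mat n e y)"
    then have ij: "i < n" "j < n" by (simp_all add: L_def coeff_mat_def)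
    then have "sl2_char (e j) (x i) = (\<Sum>m<n. newton_basis y m (y i) * newton_coeff_int y m (e j))"
      using assms by (intro newton_interpolation_int) (auto simp: y_def)
    then show "alternant n e x $$ (i, j) = (L * coeff_mat n e y) $$ (i, j)"
      using ij by (simp add: alternant_def L_def coeff_mat_def scalar_prod_def atLeast0LessThan)
  qed (simp_all add: alternant_def L_def coeff_mat_def)
  moreover have "det L = vandermonde n y"
  proof -
    have "newton_basis y j (y i) = 0" if "i < j" for i j
      using that by (auto simp: newton_basis_def intro!: bexI[of _ i])
    then have "det L = prod_list (diag_mat L)"
      by (intro det_lower_triangular[OF _ L]) (simp add: L_def)
    then show ?thesis
      by (simp add: prod_list_diag_mat[OF L]) (simp add: L_def vandermonde_def newton_basis_def)
  qed
  ultimately show ?thesis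
    using det_mult[OF L C] by (simp add: y_def)
qed

text \<open>
  Weyl's denominator formula of type \<open>C\<^sub>n\<close>: for the exponents \<open>1, \<dots>, n\<close> the interpolated
  polynomials are monic of degrees \<open>0, \<dots>, n - 1\<close>, so the matrix of divided differences is upper
  unitriangular. It serves to express the Vandermonde product as a determinant whose rows are
  permuted by a permutation of the variables.
\<close>

lemma vandermonde_eq_det:
  assumes "\<And>i. i < n \<Longrightarrow> x i \<noteq> 0 \<and> x i ^ 2 \<noteq> 1"
  shows "vandermonde n (\<lambda>i. x i + inverse (x i)) = det (alternant n (\<lambda>j. int (Suc j)) x)"
proof -
  let ?C = "coeff_mat n (\<lambda>j. int (Suc j)) (\<lambda>i. x i + inverse (x i))"
  have C: "?C \<in> carrier_mat n n" by (simp add: coeff_mat_def)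
  have c: "newton_coeff_int y m (int (Suc j)) = newton_coeff y m (Suc j)" for y m j
    by (simp add: newton_coeff_int_def nat_add_distrib)
  have "upper_triangular ?C"
    unfolding upper_triangular_def by (simp add: coeff_mat_def c newton_coeff_zero del: of_nat_Suc)
  then have "det ?C = prod_list (diag_mat ?C)" by (rule det_upper_triangular[OF _ C])
  also have "\<dots> = 1"
    unfolding prod_list_diag_mat[OF C]
    by (simp add: coeff_mat_def c newton_coeff_diag del: of_nat_Suc newton_coeff.simps)
  finally show ?thesis using det_alternant[where x = x and e = "\<lambda>j. int (Suc j)", OF assms] by simp
qed

lemma vandermonde_permute:
  assumes "\<And>i. i < n \<Longrightarrow> x i \<noteq> 0 \<and> x i ^ 2 \<noteq> 1" "p permutes {0..<n}"
  shows "vandermonde n (\<lambda>i. x (p i) + inverse (x (p i))) =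
    of_int (sign p) * vandermonde n (\<lambda>i. x i + inverse (x i))"
proof -
  have p: "p i < n" if "i < n" for i
    using permutes_in_image[OF assms(2), of i] that by simp
  let ?A = "alternant n (\<lambda>j. int (Suc j)) x"
  have "alternant n (\<lambda>j. int (Suc j)) (\<lambda>i. x (p i)) = mat n n (\<lambda>(i, j). ?A $$ (p i, j))"
    by (rule eq_matI) (auto simp: alternant_def p)
  moreover have "?A \<in> carrier_mat n n" by (simp add: alternant_def)
  ultimately show ?thesis
    using vandermonde_eq_det[of n "\<lambda>i. x (p i)"] vandermonde_eq_det[of n x] assms p
    by (simp add: det_permute_rows)
qed

lemma alternating_sum_eq_det:
  assumes "\<And>i. i < n \<Longrightarrow> x i \<noteq> 0 \<and> x i ^ 2 \<noteq> 1"
    and V: "vandermonde n (\<lambda>i. x i + inverse (x i)) \<noteq> 0"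
  shows "(\<Sum>p | p permutes {0..<n}. (\<Prod>i<n. sl2_char (e i) (x (p i))) /
      vandermonde n (\<lambda>i. x (p i) + inverse (x (p i)))) =
    det (coeff_mat n e (\<lambda>i. x i + inverse (x i)))"
proof -
  let ?V = "vandermonde n (\<lambda>i. x i + inverse (x i))"
  have A: "alternant n e x \<in> carrier_mat n n" by (simp add: alternant_def)
  have "(\<Prod>i<n. sl2_char (e i) (x (p i))) / vandermonde n (\<lambda>i. x (p i) + inverse (x (p i))) =
      of_int (sign p) * (\<Prod>i<n. alternant n e x $$ (p i, i)) / ?V"
    if "p permutes {0..<n}" for p
  proof -
    have "p i < n" if "i < n" for i
      using permutes_in_image[OF \<open>p permutes {0..<n}\<close>, of i] that by simp
    then have "(\<Prod>i<n. alternant n e x $$ (p i, i)) = (\<Prod>i<n. sl2_char (e i) (x (p i)))"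
      by (intro prod.cong) (auto simp: alternant_def)
    moreover have "(of_int (sign p) :: complex) = 1 \<or> (of_int (sign p) :: complex) = -1"
      by (simp add: sign_def)
    ultimately show ?thesis
      using vandermonde_permute[where x = x, OF assms(1) that] by (elim disjE) simp_all
  qed
  then have "(\<Sum>p | p permutes {0..<n}. (\<Prod>i<n. sl2_char (e i) (x (p i))) /
      vandermonde n (\<lambda>i. x (p i) + inverse (x (p i)))) = det (alternant n e x) / ?V"
    by (simp add: det_col[OF A] sum_divide_distrib)
  then show ?thesis using det_alternant[of n x e] assms by simp
qed

lemma laurent_fun_newton_coeff:
  assumes "\<And>m. m < n \<Longrightarrow> laurent_fun n (\<lambda>z. y z m)" "m < n"
  shows "laurent_fun n (\<lambda>z. newton_coeff (y z) m e)"
  using assms(2)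
proof (induction e arbitrary: m rule: induct_nat_012)
  case (ge2 e)
  then show ?case
    by (cases m) (auto intro!: laurent_fun_intros assms(1))
qed (auto intro: laurent_fun_intros)

lemma laurent_fun_det_coeff_mat:
  assumes "\<And>m. m < n \<Longrightarrow> laurent_fun n (\<lambda>z. y z m)"
  shows "laurent_fun n (\<lambda>z. det (coeff_mat n e (y z)))"
proof -
  have ci: "laurent_fun n (\<lambda>z. newton_coeff_int (y z) m k)" if "m < n" for m k
  proof -
    have c: "laurent_fun n (\<lambda>z. newton_coeff (y z) m j)" for j
      by (rule laurent_fun_newton_coeff[where y = y, OF assms that])
    show ?thesis
      using c[of "nat k"] laurent_fun_diff[OF laurent_fun_const[of n 0] c[of "nat (- k)"]]
      by (cases "k \<ge> 0") (simp_all add: newton_coeff_int_def)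
  qed
  have "laurent_fun n (\<lambda>z. \<Sum>p | p permutes {0..<n}. of_int (sign p) *
      (\<Prod>j<n. newton_coeff_int (y z) (p j) (e j)))"
    using permutes_in_image by (intro laurent_fun_intros ci) fastforce
  moreover have "det (coeff_mat n e (y z)) = (\<Sum>p | p permutes {0..<n}. of_int (sign p) *
      (\<Prod>j<n. newton_coeff_int (y z) (p j) (e j)))" for z
  proof -
    have C: "coeff_mat n e (y z) \<in> carrier_mat n n" by (simp add: coeff_mat_def)
    have "p j < n" if "p permutes {0..<n}" "j < n" for p j
      using permutes_in_image[OF that(1), of j] that(2) by simp
    then show ?thesis
      unfolding det_col[OF C] by (intro sum.cong refl arg_cong2[where f="(*)"] prod.cong) 
        (auto simp: coeff_mat_def)
  qed
  ultimately show ?thesis by simp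
qed

section \<open>Symmetrized quotients by the Weyl denominator\<close>

definition symplectic_denom :: "nat \<Rightarrow> (nat \<Rightarrow> complex) \<Rightarrow> complex" where
  "symplectic_denom n z = (\<Prod>i=1..n. z i - inverse (z i)) *
     vandermonde n (\<lambda>i. z (Suc i) + inverse (z (Suc i)))"

lemma sign_sum_eq_sl2_char:
  assumes "x \<noteq> 0"
  shows "(\<Sum>\<epsilon>\<in>{1, -1}. (x powi \<epsilon>) powi k / (x powi \<epsilon> - inverse (x powi \<epsilon>))) = sl2_char k x"
proof -
  let ?f = "\<lambda>\<epsilon>. (x powi \<epsilon>) powi k / (x powi \<epsilon> - inverse (x powi \<epsilon>))"
  have "x powi (-1) - inverse (x powi (-1)) = - (x - inverse x)"
    by (simp add: power_int_minus)
  moreover have "(x powi (-1)) powi k = x powi (- k)"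
    by (simp add: power_int_minus power_int_inverse)
  ultimately have "?f (-1) = - (x powi (- k) / (x - inverse x))"
    by (simp only: divide_minus_right)
  moreover have "(\<Sum>\<epsilon>\<in>{1, -1}. ?f \<epsilon>) = ?f 1 + ?f (-1)" by simp
  ultimately show ?thesis by (simp add: sl2_char_def diff_divide_distrib)
qed

text \<open>
  Matrices are indexed from \<open>0\<close> and variables from \<open>1\<close>.
\<close>

lemma sum_permutes_shift:
  "(\<Sum>\<rho> | \<rho> permutes {1..n}. G (\<lambda>i. \<rho> (Suc i))) = (\<Sum>p | p permutes {0..<n}. G (\<lambda>i. if i < n then Suc (p i) else Suc i))"
  for G :: "(nat \<Rightarrow> nat) \<Rightarrow> complex"
proof -
  have bij: "bij_betw Suc {0..<n} {1..n}"
    by (auto simp: bij_betw_def image_Suc_atLeastLessThan atLeastLessThanSuc_atLeastAtMost)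
  have "inv_into {0..<n} Suc (Suc i) = i" if "i < n" for i
    using that by (intro inv_into_f_eq) auto
  then have eq: "(\<lambda>i. if Suc i \<in> {1..n} then Suc (p (inv_into {0..<n} Suc (Suc i))) else Suc i) =
      (\<lambda>i. if i < n then Suc (p i) else Suc i)" for p
    by auto
  show ?thesis
    by (subst sum.reindex_bij_betw[OF bij_betw_permutations[OF bij], symmetric]) (simp only: eq)
qed

lemma regular_point_torus: "regular_point n z \<Longrightarrow> torus n z"
  by (auto simp: regular_point_def torus_def)

text \<open>
  The Vandermonde factor of the denominator depends on the \<open>y\<^sub>i\<close> only, so it is insensitive to the
  signs and the sum over them distributes over the variables. No sign character has to be put in by
  hand, since the denominators carry it.
\<close>

lemma symmetrized_monomial:
  assumes z: "regular_point n z"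
  shows "(\<Sum>w\<in>hyperoctahedral n. (\<Prod>i=1..n. hyp_apply w z i powi e i) /
      symplectic_denom n (hyp_apply w z)) =
    det (coeff_mat n (\<lambda>j. e (Suc j)) (\<lambda>i. z (Suc i) + inverse (z (Suc i))))"
proof -
  let ?E = "{1..n} \<rightarrow>\<^sub>E {1, -1::int}"
  let ?V = "\<lambda>\<rho>. vandermonde n (\<lambda>i. z (\<rho> (Suc i)) + inverse (z (\<rho> (Suc i))))"
  have z0: "z i \<noteq> 0" "z i ^ 2 \<noteq> 1" if "i \<in> {1..n}" for i
    using z that by (auto simp: regular_point_def)
  have inner: "(\<Sum>\<epsilon>\<in>?E. (\<Prod>i=1..n. (z (\<rho> i) powi \<epsilon> i) powi e i) /
      symplectic_denom n (\<lambda>i. z (\<rho> i) powi \<epsilon> i)) =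
      (\<Prod>i=1..n. sl2_char (e i) (z (\<rho> i))) / ?V \<rho>" if \<rho>: "\<rho> permutes {1..n}" for \<rho>
  proof -
    have "vandermonde n (\<lambda>i. z (\<rho> (Suc i)) powi \<epsilon> (Suc i) + inverse (z (\<rho> (Suc i)) powi \<epsilon> (Suc i))) = ?V \<rho>"
      if "\<epsilon> \<in> ?E" for \<epsilon>
    proof -
      have "z (\<rho> (Suc i)) powi \<epsilon> (Suc i) + inverse (z (\<rho> (Suc i)) powi \<epsilon> (Suc i)) =
          z (\<rho> (Suc i)) + inverse (z (\<rho> (Suc i)))" if "i < n" for i
      proof -
        have "\<epsilon> (Suc i) = 1 \<or> \<epsilon> (Suc i) = -1" using \<open>\<epsilon> \<in> ?E\<close> \<open>i < n\<close> by (auto simp: PiE_iff)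
        then show ?thesis by (auto simp: power_int_minus)
      qed
      then show ?thesis unfolding vandermonde_def by (intro prod.cong) auto
    qed
    then have "(\<Sum>\<epsilon>\<in>?E. (\<Prod>i=1..n. (z (\<rho> i) powi \<epsilon> i) powi e i) /
        symplectic_denom n (\<lambda>i. z (\<rho> i) powi \<epsilon> i)) =
      (\<Sum>\<epsilon>\<in>?E. (\<Prod>i=1..n. (z (\<rho> i) powi \<epsilon> i) powi e i /
        (z (\<rho> i) powi \<epsilon> i - inverse (z (\<rho> i) powi \<epsilon> i)))) / ?V \<rho>"
      by (simp add: symplectic_denom_def prod_dividef sum_divide_distrib)
    also have "\<dots> = (\<Prod>i=1..n. \<Sum>\<epsilon>\<in>{1, -1}. (z (\<rho> i) powi \<epsilon>) powi e i /
        (z (\<rho> i) powi \<epsilon> - inverse (z (\<rho> i) powi \<epsilon>))) / ?V \<rho>"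
      by (subst prod_sum_PiE) auto
    also have "\<dots> = (\<Prod>i=1..n. sl2_char (e i) (z (\<rho> i))) / ?V \<rho>"
      using z0(1) permutes_in_image[OF \<rho>]
      by (intro arg_cong2[where f="(/)"] prod.cong refl sign_sum_eq_sl2_char) auto
    finally show ?thesis .
  qed
  have "(\<Sum>w\<in>hyperoctahedral n. (\<Prod>i=1..n. hyp_apply w z i powi e i) /
      symplectic_denom n (hyp_apply w z)) =
    (\<Sum>\<rho> | \<rho> permutes {1..n}. \<Sum>\<epsilon>\<in>?E. (\<Prod>i=1..n. (z (\<rho> i) powi \<epsilon> i) powi e i) /
      symplectic_denom n (\<lambda>i. z (\<rho> i) powi \<epsilon> i))"
    unfolding hyperoctahedral_def sum.cartesian_product by (rule sum.cong) auto
  also have "\<dots> = (\<Sum>\<rho> | \<rho> permutes {1..n}. (\<Prod>i=1..n. sl2_char (e i) (z (\<rho> i))) / ?V \<rho>)"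
    by (rule sum.cong) (simp_all only: mem_Collect_eq inner)
  also have "\<dots> = (\<Sum>\<rho> | \<rho> permutes {1..n}. (\<Prod>i<n. sl2_char (e (Suc i)) (z (\<rho> (Suc i)))) / ?V \<rho>)"
    by (simp only: One_nat_def prod.atLeast1_atMost_eq)
  also have "\<dots> = (\<Sum>p | p permutes {0..<n}. (\<Prod>i<n. sl2_char (e (Suc i)) (z (Suc (p i)))) /
      vandermonde n (\<lambda>i. z (Suc (p i)) + inverse (z (Suc (p i)))))"
    using sum_permutes_shift[of "\<lambda>r. (\<Prod>i<n. sl2_char (e (Suc i)) (z (r i))) /
      vandermonde n (\<lambda>i. z (r i) + inverse (z (r i)))" n] by (simp add: vandermonde_def)
  also have "\<dots> = det (coeff_mat n (\<lambda>j. e (Suc j)) (\<lambda>i. z (Suc i) + inverse (z (Suc i))))"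
  proof (rule alternating_sum_eq_det)
    have "z (Suc i) + inverse (z (Suc i)) \<noteq> z (Suc l) + inverse (z (Suc l))" if "l < i" "i < n" for i l
    proof -
      let ?a = "z (Suc i)" and ?b = "z (Suc l)"
      have nz: "?a \<noteq> 0" "?b \<noteq> 0" using z0 that by auto
      have "?a \<noteq> ?b" "?a * ?b \<noteq> 1" using z that unfolding regular_point_def by auto
      then have "(?a - ?b) * (?a * ?b - 1) \<noteq> 0" by simp
      moreover have "(?a - ?b) * (?a * ?b - 1) = ?a * ?b * ((?a + inverse ?a) - (?b + inverse ?b))"
        using nz by (simp add: field_simps)
      ultimately show ?thesis by auto
    qed
    then show "vandermonde n (\<lambda>i. z (Suc i) + inverse (z (Suc i))) \<noteq> 0"
      by (auto simp: vandermonde_def)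
  qed (use z0 in auto)
  finally show ?thesis .
qed

lemma symmetrized_laurent_fun:
  assumes "laurent_fun n f"
  shows "\<exists>g. laurent_fun n g \<and> (\<forall>z. regular_point n z \<longrightarrow>
    (\<Sum>w\<in>hyperoctahedral n. f (hyp_apply w z) / symplectic_denom n (hyp_apply w z)) = g z)"
  using assms
proof (induction rule: laurent_fun.induct)
  case (monomial f c e)
  let ?g = "\<lambda>z. c * det (coeff_mat n (\<lambda>j. e (Suc j)) (\<lambda>i. z (Suc i) + inverse (z (Suc i))))"
  have "laurent_fun n ?g"
    by (intro laurent_fun_intros laurent_fun_det_coeff_mat) auto
  moreover have "(\<Sum>w\<in>hyperoctahedral n. f (hyp_apply w z) / symplectic_denom n (hyp_apply w z)) = ?g z"
    if z: "regular_point n z" for z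
  proof -
    have "(\<Sum>w\<in>hyperoctahedral n. f (hyp_apply w z) / symplectic_denom n (hyp_apply w z)) =
        c * (\<Sum>w\<in>hyperoctahedral n. (\<Prod>i=1..n. hyp_apply w z i powi e i) /
          symplectic_denom n (hyp_apply w z))"
      unfolding sum_distrib_left
      using monomial torus_hyp_apply[OF _ regular_point_torus[OF z]] by (intro sum.cong) simp_all
    then show ?thesis by (simp only: symmetrized_monomial[OF z])
  qed
  ultimately show ?case by blast
next
  case (add f1 f2 h)
  from add.IH obtain g1 g2 where g: "laurent_fun n g1" "laurent_fun n g2"
    "\<And>z. regular_point n z \<Longrightarrow>
      (\<Sum>w\<in>hyperoctahedral n. f1 (hyp_apply w z) / symplectic_denom n (hyp_apply w z)) = g1 z"
    "\<And>z. regular_point n z \<Longrightarrow>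
      (\<Sum>w\<in>hyperoctahedral n. f2 (hyp_apply w z) / symplectic_denom n (hyp_apply w z)) = g2 z"
    by blast
  have "(\<Sum>w\<in>hyperoctahedral n. h (hyp_apply w z) / symplectic_denom n (hyp_apply w z)) = g1 z + g2 z"
    if z: "regular_point n z" for z
    unfolding g(3,4)[OF z, symmetric] sum.distrib[symmetric]
    using add.hyps(3) torus_hyp_apply[OF _ regular_point_torus[OF z]]
    by (intro sum.cong) (simp_all add: add_divide_distrib)
  with laurent_fun_add[OF g(1,2)] show ?case by blast
qed

section \<open>The summands of \<open>K_fun\<close> and the theorem\<close>

lemma K_summand_eq:
  "\<exists>f. laurent_fun n f \<and> (\<forall>z. torus n z \<longrightarrow>
    K_summand n lam t a b t0 t1 t2 t3 z = f z / symplectic_denom n z)"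
proof -
  define u where "u k x = (if k = 0 then (1 - a * inverse x) * (1 - b * inverse x)
      else x ^ k * ((1 - t0 * inverse x) * (1 - t1 * inverse x) *
        (1 - t2 * inverse x) * (1 - t3 * inverse x)))" for k :: nat and x :: complex
  define f where "f z = (\<Prod>i=1..n. u (lam i) (z i) * z i) *
      (\<Prod>i=1..n. \<Prod>j\<in>{i<..n}.
        (1 - t * inverse (z i) * z j) * (1 - t * inverse (z i) * inverse (z j)) * (- z i))"
    for z :: "nat \<Rightarrow> complex"
    \<comment> \<open>The factor \<open>z i\<close> clears \<open>1 - inverse (z i) ^ 2\<close>. The factor \<open>- z i\<close> clears the pair \<open>i < j\<close>; its sign
      arises because \<open>vandermonde\<close> has the difference of the later and the earlier variable.\<close>
  have "laurent_fun n (\<lambda>z. u k (z i))" if "i \<in> {1..n}" for i k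
    unfolding u_def using that by (cases "k = 0") (auto intro!: laurent_fun_intros)
  moreover have "laurent_fun n (\<lambda>z. - z i)" if "i \<in> {1..n}" for i
    using laurent_fun_diff[OF laurent_fun_const[of n 0] laurent_fun_var(1)[OF that]] by simp
  ultimately have "laurent_fun n f"
    unfolding f_def by (intro laurent_fun_intros) auto
  moreover have "K_summand n lam t a b t0 t1 t2 t3 z = f z / symplectic_denom n z"
    if z: "torus n z" for z
  proof -
    let ?y = "\<lambda>i. z i + inverse (z i)"
    have "u_factor (lam i) a b t0 t1 t2 t3 (z i) = u (lam i) (z i) * z i / (z i - inverse (z i))"
      if "i \<in> {1..n}" for i
    proof -
      have "z i \<noteq> 0" using z that by (simp add: torus_def)
      then have "z i - inverse (z i) = z i * (1 - inverse (z i) ^ 2)"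
        by (simp add: field_simps power2_eq_square)
      then show ?thesis
        using \<open>z i \<noteq> 0\<close> by (auto simp: u_factor_def u_def)
    qed
    then have 1: "(\<Prod>i=1..n. u_factor (lam i) a b t0 t1 t2 t3 (z i)) =
        (\<Prod>i=1..n. u (lam i) (z i) * z i) / (\<Prod>i=1..n. z i - inverse (z i))"
      by (simp add: prod_dividef)
    have "(1 - t * inverse (z i) * z j) / (1 - inverse (z i) * z j) *
        ((1 - t * inverse (z i) * inverse (z j)) / (1 - inverse (z i) * inverse (z j))) =
        (1 - t * inverse (z i) * z j) * (1 - t * inverse (z i) * inverse (z j)) * (- z i) / (?y j - ?y i)"
      if "i \<in> {1..n}" "j \<in> {i<..n}" for i j
    proof -
      have nz: "z i \<noteq> 0" "z j \<noteq> 0" using z that by (auto simp: torus_def)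
      then have "?y j - ?y i = - z i * ((1 - inverse (z i) * z j) * (1 - inverse (z i) * inverse (z j)))"
        by (simp add: field_simps)
      then show ?thesis using nz by simp
    qed
    then have 2: "(\<Prod>i=1..n. \<Prod>j\<in>{i<..n}. (1 - t * inverse (z i) * z j) / (1 - inverse (z i) * z j) *
        ((1 - t * inverse (z i) * inverse (z j)) / (1 - inverse (z i) * inverse (z j)))) =
        (\<Prod>i=1..n. \<Prod>j\<in>{i<..n}.
          (1 - t * inverse (z i) * z j) * (1 - t * inverse (z i) * inverse (z j)) * (- z i) / (?y j - ?y i))"
      by (intro prod.cong refl)
    note 2 = 2[unfolded prod_dividef]
    have "(\<Prod>i=1..n. \<Prod>j\<in>{i<..n}. ?y j - ?y i) = (\<Prod>j=1..n. \<Prod>i=1..<j. ?y j - ?y i)"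
      unfolding prod.Sigma[OF finite_atLeastAtMost ballI[OF finite_greaterThanAtMost]]
        prod.Sigma[OF finite_atLeastAtMost ballI[OF finite_atLeastLessThan]]
      by (rule prod.reindex_bij_witness[of _ "\<lambda>(j, i). (i, j)" "\<lambda>(i, j). (j, i)"]) auto
    also have "\<dots> = (\<Prod>j<n. \<Prod>i<j. ?y (Suc j) - ?y (Suc i))"
      by (simp add: prod.atLeast1_atMost_eq atLeastLessThanSuc_atLeastAtMost)
    finally show ?thesis
      unfolding K_summand_def 1 2 by (simp add: f_def symplectic_denom_def vandermonde_def)
  qed
  ultimately show ?thesis by blast
qed

lemma K_summand_local:
  "(\<And>i. i \<in> {1..n} \<Longrightarrow> x i = y i) \<Longrightarrow>
    K_summand n lam t a b t0 t1 t2 t3 x = K_summand n lam t a b t0 t1 t2 t3 y"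
  unfolding K_summand_def by (intro arg_cong2[where f = "(*)"] prod.cong) auto

lemma regular_point_hyp_apply:
  assumes w: "w \<in> hyperoctahedral n" and z: "regular_point n z"
  shows "regular_point n (hyp_apply w z)"
proof -
  have zr: "z i \<noteq> 0" "z i ^ 2 \<noteq> 1" if "i \<in> {1..n}" for i
    using z that by (auto simp: regular_point_def)
  have inj: "inj (fst w)"
    using w by (auto simp: hyperoctahedral_def intro: permutes_inj)
  have "hyp_apply w z i \<noteq> 0 \<and> hyp_apply w z i ^ 2 \<noteq> 1" if "i \<in> {1..n}" for i
    using zr[OF hyperoctahedral_cases(1)[OF w that]] hyperoctahedral_cases(2)[OF w that]
    by (auto simp: power_int_minus power_inverse)
  moreover have "hyp_apply w z i \<noteq> hyp_apply w z j \<and> hyp_apply w z i * hyp_apply w z j \<noteq> 1"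
    if ij: "i \<in> {1..n}" "j \<in> {1..n}" "i \<noteq> j" for i j
  proof -
    let ?a = "z (fst w i)" and ?b = "z (fst w j)"
    have "fst w i \<noteq> fst w j" using inj ij(3) by (auto dest: injD)
    then have "?a \<noteq> ?b" "?a * ?b \<noteq> 1" "?a \<noteq> 0" "?b \<noteq> 0"
      using z hyperoctahedral_cases(1)[OF w ij(1)] hyperoctahedral_cases(1)[OF w ij(2)]
      unfolding regular_point_def by blast+
    then show ?thesis
      using hyperoctahedral_cases(2)[OF w ij(1)] hyperoctahedral_cases(2)[OF w ij(2)]
      by (auto simp: power_int_minus field_simps)
  qed
  ultimately show ?thesis unfolding regular_point_def by blast
qed

lemma laurent_fun_hyp_apply:
  assumes "laurent_fun n f" "w \<in> hyperoctahedral n"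
  shows "laurent_fun n (\<lambda>z. f (hyp_apply w z))"
  using assms(1)
proof (induction rule: laurent_fun.induct)
  case (monomial f c e)
  have "laurent_fun n (\<lambda>z. c * (\<Prod>i=1..n. z (fst w i) powi (snd w i * e i)))"
    using hyperoctahedral_cases(1)[OF assms(2)] by (intro laurent_fun_intros) auto
  then show ?case
    by (rule laurent_fun_cong)
      (simp add: monomial torus_hyp_apply[OF assms(2)] power_int_mult)
next
  case (add f g h)
  show ?case
    by (rule laurent_fun.add[OF add.IH]) (use add.hyps torus_hyp_apply[OF assms(2)] in simp)
qed

text \<open>
  The two symmetries in \<open>BC_symmetric\<close> come from the elements of the group with trivial signs
  and from those with trivial permutation and one negative sign.
\<close>

lemma hyperoctahedral_invariant_generators:
  assumes inv: "\<And>v z. v \<in> hyperoctahedral n \<Longrightarrow> torus n z \<Longrightarrow> H (hyp_apply v z) = H z"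
    and H: "laurent_fun n H"
    and z: "torus n z"
  shows "\<rho> permutes {1..n} \<Longrightarrow> H (\<lambda>i. z (\<rho> i)) = H z"
    and "i \<in> {1..n} \<Longrightarrow> H (z(i := inverse (z i))) = H z"
proof -
  assume \<rho>: "\<rho> permutes {1..n}"
  let ?v = "(\<rho>, \<lambda>i\<in>{1..n}. 1 :: int)"
  have v: "?v \<in> hyperoctahedral n" using \<rho> by (auto simp: hyperoctahedral_def)
  have "H (hyp_apply ?v z) = H (\<lambda>i. z (\<rho> i))"
    by (rule laurent_fun_local[OF H torus_hyp_apply[OF v z]]) simp
  then show "H (\<lambda>i. z (\<rho> i)) = H z" using inv[OF v z] by simp
next
  assume i: "i \<in> {1..n}"
  let ?v = "(id, \<lambda>j\<in>{1..n}. if j = i then -1 else 1 :: int)"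
  have v: "?v \<in> hyperoctahedral n" by (auto simp: hyperoctahedral_def permutes_id)
  have "H (hyp_apply ?v z) = H (z(i := inverse (z i)))"
    by (rule laurent_fun_local[OF H torus_hyp_apply[OF v z]]) (auto simp: power_int_minus)
  then show "H (z(i := inverse (z i))) = H z" using inv[OF v z] by simp
qed

theorem theorem2p5:
  fixes n :: nat and lam :: "nat \<Rightarrow> nat" and t a b t0 t1 t2 t3 :: complex
  assumes "n \<ge> 1"
    and "is_partition n lam"
    and "norm t < 1" and "norm a < 1" and "norm b < 1"
    and "norm t0 < 1" and "norm t1 < 1" and "norm t2 < 1" and "norm t3 < 1"
  shows "\<exists>P. laurent_vars_le n P \<and> BC_symmetric n P \<and>
           (\<forall>z. regular_point n z \<longrightarrow>
              K_fun n lam z t a b t0 t1 t2 t3 = laurent_eval P z)"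
proof -
  define K where "K z = K_fun n lam z t a b t0 t1 t2 t3" for z
  define W where "W = hyperoctahedral n"
  let ?c = "1 / v_norm n lam t a b t0 t1 t2 t3"
  let ?s = "K_summand n lam t a b t0 t1 t2 t3"
  have K_sum: "K z = ?c * (\<Sum>w\<in>W. ?s (hyp_apply w z))" for z
    by (simp add: K_def K_fun_def hyperoctahedral_act_def W_def)
  obtain f where f: "laurent_fun n f" "\<And>z. torus n z \<Longrightarrow> ?s z = f z / symplectic_denom n z"
    using K_summand_eq[of n lam t a b t0 t1 t2 t3] by blast
  obtain g0 where g0: "laurent_fun n g0" "\<And>z. regular_point n z \<Longrightarrow>
      (\<Sum>w\<in>W. f (hyp_apply w z) / symplectic_denom n (hyp_apply w z)) = g0 z"
    using symmetrized_laurent_fun[OF f(1)] unfolding W_def by blast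
  define g where "g z = ?c * g0 z" for z
  have g: "laurent_fun n g" unfolding g_def by (intro laurent_fun_intros g0)
  have K_g: "K z = g z" if z: "regular_point n z" for z
    unfolding K_sum g_def g0(2)[OF z, symmetric] W_def
    using f(2) torus_hyp_apply[OF _ regular_point_torus[OF z]] by simp
  \<comment> \<open>So far the symmetry of \<open>g\<close> is known at regular points only; its average has it everywhere.\<close>
  define H where "H z = (1 / of_nat (card W)) * (\<Sum>w\<in>W. g (hyp_apply w z))" for z
  have H: "laurent_fun n H"
    unfolding H_def W_def by (intro laurent_fun_intros laurent_fun_hyp_apply[OF g])
  have H_inv: "H (hyp_apply v z) = H z" if "v \<in> hyperoctahedral n" "torus n z" for v z
  proof -
    have "(\<Sum>w\<in>hyperoctahedral n. g (hyp_apply w (hyp_apply v z))) =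
        (\<Sum>w\<in>hyperoctahedral n. g (hyp_apply w z))"
      by (rule hyperoctahedral_sum_invariant[OF _ that]) (rule laurent_fun_local[OF g])
    then show ?thesis by (simp only: H_def W_def)
  qed
  have K_H: "K z = H z" if z: "regular_point n z" for z
  proof -
    have "g (hyp_apply w z) = K z" if w: "w \<in> W" for w
    proof -
      have "K (hyp_apply w z) = K z"
        unfolding K_sum W_def
        by (subst hyperoctahedral_sum_invariant[where F = ?s])
          (use w regular_point_torus[OF z] in \<open>auto simp: W_def intro: K_summand_local\<close>)
      then show ?thesis
        using K_g[OF regular_point_hyp_apply[OF w[unfolded W_def] z]] by simp
    qed
    moreover have "card W \<noteq> 0"
    proof -
      have "(id, \<lambda>i\<in>{1..n}. 1) \<in> W" by (auto simp: W_def hyperoctahedral_def permutes_id)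
      then show ?thesis using finite_hyperoctahedral[of n] unfolding W_def by auto
    qed
    ultimately show ?thesis by (simp add: H_def)
  qed
  obtain P where P: "laurent_vars_le n P" "\<And>z. torus n z \<Longrightarrow> laurent_eval P z = H z"
    using laurent_fun_imp_laurent_eval[OF H] by blast
  have "BC_symmetric n P"
    unfolding BC_symmetric_def
  proof (intro allI impI conjI ballI)
    fix z :: "nat \<Rightarrow> complex" and \<rho> assume "\<forall>i\<in>{1..n}. z i \<noteq> 0" and \<rho>: "\<rho> permutes {1..n}"
    then have z: "torus n z" by (simp add: torus_def)
    then have "torus n (\<lambda>i. z (\<rho> i))" using permutes_in_image[OF \<rho>] by (auto simp: torus_def)
    then show "laurent_eval P (\<lambda>i. z (\<rho> i)) = laurent_eval P z"
      using hyperoctahedral_invariant_generators(1)[where H = H, OF H_inv H z \<rho>] z P(2) by simp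
  next
    fix z :: "nat \<Rightarrow> complex" and i assume "\<forall>i\<in>{1..n}. z i \<noteq> 0" and i: "i \<in> {1..n}"
    then have z: "torus n z" by (simp add: torus_def)
    then have "torus n (z(i := inverse (z i)))" by (auto simp: torus_def)
    then show "laurent_eval P (z(i := inverse (z i))) = laurent_eval P z"
      using hyperoctahedral_invariant_generators(2)[where H = H, OF H_inv H z i] z P(2) by simp
  qed
  moreover have "K_fun n lam z t a b t0 t1 t2 t3 = laurent_eval P z" if "regular_point n z" for z
    using K_H[OF that] P(2)[OF regular_point_torus[OF that]] by (simp add: K_def)
  ultimately show ?thesis using P(1) by blast
qed

end
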